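(* Let $f:\mathbb{R}\to\mathbb{R}$ be continuous with $\lim_{|x|\to\infty} f(x)/x=0$, let $k=(k(n))_{n\ge 0}$ be a real sequence with $\sum_{j=0}^\infty |k(j)|<+\infty$, let $(H(n))_{n\ge 1}$ be a real sequence, let $\xi\in\mathbb{R}$, and let $(x(n))_{n\ge 0}$ be the real sequence defined by $x(0)=\xi$ and $$x(n+1)=H(n+1)+\sum_{j=0}^n k(n-j)f(x(j)),\quad n\ge 0.$$ (i) The following statements are equivalent: (a) $H(n)$ is asymptotic to an increasing sequence and $H(n)\to\infty$ as $n\to\infty$; (b) $x(n)$ is asymptotic to an increasing sequence and $x(n)\to\infty$ as $n\to\infty$. Moreover, both statements imply that $\lim_{n\to\infty}x(n)/H(n)=1$. (ii) The following statements are equivalent: (a) $H(n)$ is asymptotic to a decreasing sequence and $H(n)\to-\infty$ as $n\to\infty$; (b) $x(n)$ is asymptotic to a decreasing sequence and $x(n)\to-\infty$ as $n\to\infty$. Moreover, both statements imply that $\lim_{n\to\infty}x(n)/H(n)=1$.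
   Context: A sequence $u(n)$ is asymptotic to a sequence $v(n)$ (written $u(n)\sim v(n)$ as $n\to\infty$) if $u(n)/v(n)\to1$ as $n\to\infty$. *)

theory Defs
  imports "HOL-Analysis.Analysis"
begin

(* Unlike the library relation asymp_equiv, this is the plain limit of the quotient, so two
   eventually vanishing sequences are not asymptotic: since x / 0 = 0, the limit 1 forces both
   sequences to be eventually nonzero. *)
definition asymptotic_to :: "(nat \<Rightarrow> real) \<Rightarrow> (nat \<Rightarrow> real) \<Rightarrow> bool" where
  "asymptotic_to u v \<longleftrightarrow> (\<lambda>n. u n / v n) \<longlonglongrightarrow> 1"

(* Increasing and decreasing are meant in the non-strict sense.  For the divergent sequences
   considered here the strict reading gives the same notion: if v is non-decreasing and tends to
   infinity, then v n - 1 / (n + 1) is strictly increasing and asymptotic to v. *)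
definition asymptotic_to_increasing :: "(nat \<Rightarrow> real) \<Rightarrow> bool" where
  "asymptotic_to_increasing u \<longleftrightarrow> (\<exists>v. incseq v \<and> asymptotic_to u v)"

definition asymptotic_to_decreasing :: "(nat \<Rightarrow> real) \<Rightarrow> bool" where
  "asymptotic_to_decreasing u \<longleftrightarrow> (\<exists>v. decseq v \<and> asymptotic_to u v)"

end

theory Submission
  imports Defs
begin

text \<open>
  Put \<open>S n = (\<Sum>j=0..n. k (n - j) * f (x j))\<close>, so that \<open>x (n + 1) = H (n + 1) + S n\<close>.  The theorem
  holds because \<open>S\<close> is negligible on the scale of any increasing divergent weight \<open>w \<ge> 1\<close> that
  dominates \<open>x\<close>: as \<open>f\<close> is sublinear, \<open>\<bar>f t\<bar> \<le> C + \<epsilon> * \<bar>t\<bar>\<close> with \<open>\<epsilon>\<close> as small as desired, and since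
  \<open>k\<close> is absolutely summable and \<open>w\<close> is increasing, \<open>S n\<close> is at most a constant plus \<open>\<epsilon> * w n\<close> up to a
  fixed factor (\<open>convolution_negligible\<close>).

  If \<open>x n / w n\<close> converges, then \<open>w\<close> dominates \<open>x\<close> at once.  If \<open>H n / w n\<close> converges, the bound
  passes from \<open>H\<close> to \<open>x\<close> by induction, once \<open>\<epsilon>\<close> is so small that the contribution of \<open>S\<close> is absorbed
  (\<open>forcing_bound_transfers\<close>).  Hence \<open>x / w\<close> and \<open>H / w\<close> have the same limit as soon as one of them converges
  (\<open>solution_forcing_same_weighted_limit\<close>).

  It remains to rephrase the two growth conditions: diverging to \<open>\<infinity>\<close> and being asymptotic to an
  increasing sequence means that \<open>u / w\<close> tends to \<open>1\<close> for some such weight \<open>w\<close>, while diverging to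
  \<open>-\<infinity>\<close> and being asymptotic to a decreasing sequence means that \<open>u / w\<close> tends to \<open>-1\<close>.
  So both parts are instances of one statement, for the limits \<open>1\<close> and \<open>-1\<close>.
\<close>

section \<open>Growth weights\<close>

definition growth_weight :: "(nat \<Rightarrow> real) \<Rightarrow> bool" where
  "growth_weight w \<longleftrightarrow> incseq w \<and> (\<forall>n. 1 \<le> w n) \<and> filterlim w at_top sequentially"

text \<open>
  A divergent increasing sequence may be replaced by its maximum with \<open>1\<close>, as this changes only
  finitely many terms; positivity of the weight then makes division by it harmless everywhere.
\<close>

lemma increasing_divergent_iff_weight:
  "asymptotic_to_increasing u \<and> filterlim u at_top sequentially \<longleftrightarrow>
    (\<exists>w. growth_weight w \<and> (\<lambda>n. u n / w n) \<longlonglongrightarrow> 1)" (is "?L \<longleftrightarrow> ?R")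
proof
  assume ?L
  then obtain v where v: "incseq v" "(\<lambda>n. u n / v n) \<longlonglongrightarrow> 1" and u: "filterlim u at_top sequentially"
    by (auto simp: asymptotic_to_increasing_def asymptotic_to_def)
  have "(\<lambda>n. inverse (u n / v n)) \<longlonglongrightarrow> 1"
    using tendsto_inverse[OF v(2)] by simp
  then have "filterlim (\<lambda>n. inverse (u n / v n) * u n) at_top sequentially"
    by (rule filterlim_tendsto_pos_mult_at_top[OF _ _ u]) simp
  moreover have "\<forall>\<^sub>F n in sequentially. inverse (u n / v n) * u n = v n"
    using filterlim_at_top_dense[THEN iffD1, OF u, rule_format, of 0]
    by eventually_elim (simp add: field_simps)
  ultimately have v_top: "filterlim v at_top sequentially"
    using filterlim_cong by fast
  define w where "w n = max 1 (v n)" for n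
  have "incseq w"
    using v(1) by (force simp: w_def incseq_def max_def)
  moreover have "filterlim w at_top sequentially"
    by (rule filterlim_at_top_mono[OF v_top]) (simp add: w_def)
  moreover have "\<forall>\<^sub>F n in sequentially. u n / v n = u n / w n"
    using filterlim_at_top[THEN iffD1, OF v_top, rule_format, of 1]
    by eventually_elim (simp add: w_def)
  then have "(\<lambda>n. u n / w n) \<longlonglongrightarrow> 1"
    using v(2) by (rule Lim_transform_eventually[rotated])
  ultimately show ?R
    by (auto simp: growth_weight_def w_def)
next
  assume ?R
  then obtain w where w: "growth_weight w" and lim: "(\<lambda>n. u n / w n) \<longlonglongrightarrow> 1" by blast
  have w_top: "filterlim w at_top sequentially" and w_ge: "1 \<le> w n" for n
    using w by (auto simp: growth_weight_def)
  have "filterlim (\<lambda>n. u n / w n * w n) at_top sequentially"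
    by (rule filterlim_tendsto_pos_mult_at_top[OF lim _ w_top]) simp
  moreover have "u n / w n * w n = u n" for n
    using w_ge[of n] by simp
  ultimately show ?L
    using w lim by (auto simp: asymptotic_to_increasing_def asymptotic_to_def growth_weight_def)
qed

lemma decreasing_divergent_iff_weight:
  "asymptotic_to_decreasing u \<and> filterlim u at_bot sequentially \<longleftrightarrow>
    (\<exists>w. growth_weight w \<and> (\<lambda>n. u n / w n) \<longlonglongrightarrow> -1)"
proof -
  have "asymptotic_to_decreasing u \<longleftrightarrow> asymptotic_to_increasing (\<lambda>n. - u n)"
  proof
    assume "asymptotic_to_decreasing u"
    then obtain v where "decseq v" "asymptotic_to u v"
      by (auto simp: asymptotic_to_decreasing_def)
    then have "incseq (\<lambda>n. - v n) \<and> asymptotic_to (\<lambda>n. - u n) (\<lambda>n. - v n)"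
      by (simp add: asymptotic_to_def incseq_def decseq_def)
    then show "asymptotic_to_increasing (\<lambda>n. - u n)"
      unfolding asymptotic_to_increasing_def by blast
  next
    assume "asymptotic_to_increasing (\<lambda>n. - u n)"
    then obtain v where "incseq v" "asymptotic_to (\<lambda>n. - u n) v"
      by (auto simp: asymptotic_to_increasing_def)
    then have "decseq (\<lambda>n. - v n) \<and> asymptotic_to u (\<lambda>n. - v n)"
      by (simp add: asymptotic_to_def incseq_def decseq_def)
    then show "asymptotic_to_decreasing u"
      unfolding asymptotic_to_decreasing_def by blast
  qed
  moreover have "(\<lambda>n. - u n / w n) \<longlonglongrightarrow> 1 \<longleftrightarrow> (\<lambda>n. u n / w n) \<longlonglongrightarrow> -1" for w
    using tendsto_minus_cancel_left[of "\<lambda>n. u n / w n" 1 sequentially] by simp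
  ultimately show ?thesis
    using increasing_divergent_iff_weight[of "\<lambda>n. - u n"]
    by (simp add: filterlim_uminus_at_bot)
qed

lemma weighted_convergent_imp_bounded:
  assumes "growth_weight w" and "(\<lambda>n. u n / w n) \<longlonglongrightarrow> L"
  obtains M where "M \<ge> 0" "\<And>n. \<bar>u n\<bar> \<le> M * w n"
proof -
  obtain M where M: "M > 0" "\<And>n. \<bar>u n / w n\<bar> \<le> M"
    using BseqE[OF convergent_imp_Bseq[OF convergentI[OF assms(2)]]] by auto
  have "\<bar>u n\<bar> \<le> M * w n" for n
  proof -
    have "w n \<ge> 1" using assms(1) by (simp add: growth_weight_def)
    then show ?thesis
      using M(2)[of n] by (simp add: abs_divide pos_divide_le_eq)
  qed
  then show ?thesis using that M(1) by (meson less_imp_le)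
qed

section \<open>Convolutions of sublinear functions\<close>

text \<open>
  Near infinity the term \<open>\<epsilon> * \<bar>t\<bar>\<close> suffices; on the remaining compact interval continuity provides
  the constant.
\<close>

lemma sublinear_bound:
  fixes f :: "real \<Rightarrow> real"
  assumes "continuous_on UNIV f" and "((\<lambda>t. f t / t) \<longlongrightarrow> 0) at_infinity" and "\<epsilon> > 0"
  obtains C where "C \<ge> 0" "\<And>t. \<bar>f t\<bar> \<le> C + \<epsilon> * \<bar>t\<bar>"
proof -
  obtain b where b: "\<And>t. b \<le> \<bar>t\<bar> \<Longrightarrow> \<bar>f t / t\<bar> < \<epsilon>"
    using tendstoD[OF assms(2,3)] by (auto simp: eventually_at_infinity)
  have "bounded (f ` {-\<bar>b\<bar>-1..\<bar>b\<bar>+1})"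
    by (intro compact_imp_bounded compact_continuous_image continuous_on_subset[OF assms(1)]) auto
  then obtain C where C: "C > 0" "\<And>t. t \<in> {-\<bar>b\<bar>-1..\<bar>b\<bar>+1} \<Longrightarrow> \<bar>f t\<bar> \<le> C"
    by (auto simp: bounded_pos)
  have "\<bar>f t\<bar> \<le> C + \<epsilon> * \<bar>t\<bar>" for t
  proof (cases "\<bar>t\<bar> \<le> \<bar>b\<bar> + 1")
    case True
    then have "\<bar>f t\<bar> \<le> C" by (intro C(2)) auto
    then show ?thesis using assms(3) by (simp add: add_increasing2)
  next
    case False
    then have "\<bar>f t\<bar> / \<bar>t\<bar> < \<epsilon>" "\<bar>t\<bar> > 0" using b[of t] by (auto simp: abs_divide)
    then show ?thesis using C(1) by (simp add: pos_divide_less_eq)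
  qed
  then show ?thesis using that C(1) by (meson less_imp_le)
qed

lemma convolution_bound:
  fixes k g :: "nat \<Rightarrow> real"
  assumes "summable (\<lambda>j. \<bar>k j\<bar>)" and "\<And>j. j \<le> n \<Longrightarrow> \<bar>g j\<bar> \<le> G"
  shows "\<bar>\<Sum>j=0..n. k (n - j) * g j\<bar> \<le> (\<Sum>j. \<bar>k j\<bar>) * G"
proof -
  have "G \<ge> 0" using assms(2)[of 0] by auto
  have "\<bar>\<Sum>j=0..n. k (n - j) * g j\<bar> \<le> (\<Sum>j=0..n. \<bar>k (n - j)\<bar> * G)"
    using assms(2) by (intro sum_abs[THEN order_trans] sum_mono) (auto simp: abs_mult mult_left_mono)
  also have "\<dots> = (\<Sum>j=0..n. \<bar>k j\<bar>) * G"
    using sum.nat_diff_reindex[of "\<lambda>j. \<bar>k j\<bar>" "Suc n"]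
    by (simp add: sum_distrib_right[symmetric] atLeast0AtMost lessThan_Suc_atMost)
  also have "\<dots> \<le> (\<Sum>j. \<bar>k j\<bar>) * G"
    using assms(1) \<open>G \<ge> 0\<close> by (intro mult_right_mono sum_le_suminf) auto
  finally show ?thesis .
qed

text \<open>
  The convolution only looks at the past \<open>j \<le> n\<close>, where an increasing weight never exceeds \<open>w n\<close>;
  hence a domination of \<open>x\<close> by \<open>w\<close> survives the convolution with a summable kernel.
\<close>

lemma sublinear_convolution_bound:
  fixes f :: "real \<Rightarrow> real"
  assumes "summable (\<lambda>j. \<bar>k j\<bar>)" and "\<epsilon> \<ge> 0" and "\<And>t. \<bar>f t\<bar> \<le> C + \<epsilon> * \<bar>t\<bar>"
    and "growth_weight w" and "M \<ge> 0" and "\<And>j. j \<le> n \<Longrightarrow> \<bar>x j\<bar> \<le> M * w j"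
  shows "\<bar>\<Sum>j=0..n. k (n - j) * f (x j)\<bar> \<le> (\<Sum>j. \<bar>k j\<bar>) * (C + \<epsilon> * (M * w n))"
proof (rule convolution_bound[OF assms(1)])
  fix j assume "j \<le> n"
  then have "w j \<le> w n" using assms(4) by (auto simp: growth_weight_def incseq_def)
  then have "\<bar>x j\<bar> \<le> M * w n"
    using assms(6)[OF \<open>j \<le> n\<close>] assms(5) by (meson mult_left_mono order_trans)
  then have "\<epsilon> * \<bar>x j\<bar> \<le> \<epsilon> * (M * w n)" using assms(2) by (rule mult_left_mono)
  then show "\<bar>f (x j)\<bar> \<le> C + \<epsilon> * (M * w n)" using assms(3)[of "x j"] by linarith
qed

lemma convolution_negligible:
  fixes f :: "real \<Rightarrow> real"
  assumes "continuous_on UNIV f" and "((\<lambda>t. f t / t) \<longlongrightarrow> 0) at_infinity"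
    and k: "summable (\<lambda>j. \<bar>k j\<bar>)"
    and w: "growth_weight w" and M: "M \<ge> 0" "\<And>j. \<bar>x j\<bar> \<le> M * w j"
  shows "(\<lambda>n. (\<Sum>j=0..n. k (n - j) * f (x j)) / w (Suc n)) \<longlonglongrightarrow> 0"
proof (rule tendstoI)
  fix e :: real assume "e > 0"
  define K where "K = (\<Sum>j. \<bar>k j\<bar>)"
  have "K \<ge> 0" using k by (simp add: K_def suminf_nonneg)
  \<comment> \<open>One half of \<open>e\<close> is spent on the linear part, the other on the constant \<open>K * C\<close>; the summand
    \<open>1\<close> covers the case \<open>K * M = 0\<close>.\<close>
  define \<epsilon> where "\<epsilon> = e / (2 * (K * M + 1))"
  have "K * M + 1 > 0" using \<open>K \<ge> 0\<close> M(1) by (simp add: add_nonneg_pos)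
  then have eps: "\<epsilon> > 0" "K * (\<epsilon> * M) \<le> e / 2"
    using \<open>e > 0\<close> by (auto simp: \<epsilon>_def field_simps)
  obtain C where C: "C \<ge> 0" "\<And>t. \<bar>f t\<bar> \<le> C + \<epsilon> * \<bar>t\<bar>"
    using sublinear_bound[OF assms(1,2) eps(1)] by blast
  have "filterlim (\<lambda>n. w (Suc n)) at_top sequentially"
    using w by (simp add: growth_weight_def filterlim_sequentially_Suc)
  then have "\<forall>\<^sub>F n in sequentially. 2 * K * C / e < w (Suc n)"
    by (simp add: filterlim_at_top_dense)
  then show "\<forall>\<^sub>F n in sequentially.
      dist ((\<Sum>j=0..n. k (n - j) * f (x j)) / w (Suc n)) 0 < e"
  proof eventually_elim
    case (elim n)
    have w_pos: "w (Suc n) > 0" and w_mono: "w n \<le> w (Suc n)"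
      using w by (auto simp: growth_weight_def incseq_def intro: less_le_trans[of 0 1])
    have "0 \<le> w n" using w by (auto simp: growth_weight_def intro: order_trans[of 0 1])
    have "\<bar>\<Sum>j=0..n. k (n - j) * f (x j)\<bar> \<le> K * (C + \<epsilon> * (M * w n))"
      unfolding K_def using sublinear_convolution_bound[OF k _ C(2) w M(1)] eps(1) M(2) by simp
    also have "\<dots> = K * C + K * (\<epsilon> * M) * w n" by (simp add: algebra_simps)
    also have "\<dots> \<le> K * C + e / 2 * w (Suc n)"
      using eps(2) w_mono \<open>0 \<le> w n\<close> \<open>e > 0\<close> by (intro add_left_mono mult_mono) auto
    also have "\<dots> < e * w (Suc n)"
      using elim \<open>e > 0\<close> by (simp add: field_simps)
    finally show ?case using w_pos by (simp add: dist_real_def abs_divide pos_divide_less_eq)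
  qed
qed

section \<open>Comparison of solution and forcing\<close>

text \<open>
  With \<open>\<epsilon>\<close> chosen such that the total mass of \<open>k\<close> times \<open>\<epsilon>\<close> is at most \<open>1/2\<close>, the convolution
  reproduces at most half of a bound on the past of \<open>x\<close>, so a constant twice as large as the
  remaining contributions is preserved by the recursion.
\<close>

lemma forcing_bound_transfers:
  fixes f :: "real \<Rightarrow> real"
  assumes "continuous_on UNIV f" and "((\<lambda>t. f t / t) \<longlongrightarrow> 0) at_infinity"
    and k: "summable (\<lambda>j. \<bar>k j\<bar>)"
    and rec: "\<And>n. x (Suc n) = H (Suc n) + (\<Sum>j=0..n. k (n - j) * f (x j))"
    and w: "growth_weight w" and A: "A \<ge> 0" "\<And>n. \<bar>H n\<bar> \<le> A * w n"
  obtains M where "M \<ge> 0" "\<And>n. \<bar>x n\<bar> \<le> M * w n"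
proof -
  define K where "K = (\<Sum>j. \<bar>k j\<bar>)"
  have "K \<ge> 0" using k by (simp add: K_def suminf_nonneg)
  define \<epsilon> where "\<epsilon> = 1 / (2 * (K + 1))"
  have eps: "\<epsilon> > 0" "K * \<epsilon> \<le> 1 / 2"
    using \<open>K \<ge> 0\<close> by (auto simp: \<epsilon>_def field_simps)
  obtain C where C: "C \<ge> 0" "\<And>t. \<bar>f t\<bar> \<le> C + \<epsilon> * \<bar>t\<bar>"
    using sublinear_bound[OF assms(1,2) eps(1)] by blast
  have w_ge: "1 \<le> w n" and w_mono: "w n \<le> w (Suc n)" for n
    using w by (auto simp: growth_weight_def incseq_def)
  \<comment> \<open>\<open>M = A + K * C + M / 2\<close> would close the induction step; \<open>\<bar>x 0\<bar>\<close> is added for the start, as the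
    recursion does not relate \<open>x 0\<close> to \<open>H 0\<close>.\<close>
  define M where "M = 2 * (A + K * C + \<bar>x 0\<bar>)"
  have M: "M \<ge> 0" "M \<ge> \<bar>x 0\<bar>" "A + K * C \<le> M / 2"
    using \<open>K \<ge> 0\<close> A(1) C(1) by (auto simp: M_def)
  have "\<bar>x n\<bar> \<le> M * w n" for n
  proof (induction n rule: less_induct)
    case (less n)
    show ?case
    proof (cases n)
      case 0
      have "M * 1 \<le> M * w 0" using w_ge M(1) by (intro mult_left_mono)
      then show ?thesis using 0 M(2) by simp
    next
      case (Suc m)
      have "\<bar>\<Sum>j=0..m. k (m - j) * f (x j)\<bar> \<le> K * (C + \<epsilon> * (M * w m))"
        unfolding K_def
        using sublinear_convolution_bound[OF k _ C(2) w M(1)] eps(1) less Suc by simp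
      also have "\<dots> = K * C * 1 + K * \<epsilon> * (M * w m)" by (simp add: algebra_simps)
      also have "\<dots> \<le> K * C * w (Suc m) + 1 / 2 * (M * w (Suc m))"
      proof (intro add_mono mult_left_mono mult_mono w_ge w_mono eps(2) M(1))
        show "0 \<le> M * w m" using M(1) w_ge[of m] by simp
      qed (use \<open>K \<ge> 0\<close> C(1) in auto)
      finally have "\<bar>x n\<bar> \<le> A * w n + (K * C * w n + 1 / 2 * (M * w n))"
        using A(2)[of n] rec[of m] Suc by simp
      also have "\<dots> = (A + K * C) * w n + M / 2 * w n" by (simp add: algebra_simps)
      also have "\<dots> \<le> M / 2 * w n + M / 2 * w n"
        using M(3) w_ge[of n] by (intro add_right_mono mult_right_mono) auto
      finally show ?thesis by simp
    qed
  qed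
  then show ?thesis using that M(1) by blast
qed

text \<open>
  Both directions come down to dominating \<open>x\<close> by \<open>w\<close>: then the difference of the two quotients is
  the convolution divided by the weight, which tends to \<open>0\<close>.
\<close>

lemma solution_forcing_same_weighted_limit:
  fixes f :: "real \<Rightarrow> real"
  assumes f: "continuous_on UNIV f" "((\<lambda>t. f t / t) \<longlongrightarrow> 0) at_infinity"
    and k: "summable (\<lambda>j. \<bar>k j\<bar>)"
    and rec: "\<And>n. x (Suc n) = H (Suc n) + (\<Sum>j=0..n. k (n - j) * f (x j))"
    and w: "growth_weight w"
  shows "(\<lambda>n. H n / w n) \<longlonglongrightarrow> L \<longleftrightarrow> (\<lambda>n. x n / w n) \<longlonglongrightarrow> L"
proof -
  have limits_agree: "(\<lambda>n. H n / w n) \<longlonglongrightarrow> L \<longleftrightarrow> (\<lambda>n. x n / w n) \<longlonglongrightarrow> L"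
    if M: "M \<ge> 0" "\<And>n. \<bar>x n\<bar> \<le> M * w n" for M
  proof -
    have "(\<lambda>n. x (Suc n) / w (Suc n) - H (Suc n) / w (Suc n)) \<longlonglongrightarrow> 0"
      using convolution_negligible[OF f k w M] by (simp add: rec add_divide_distrib)
    then have diff: "(\<lambda>n. x n / w n - H n / w n) \<longlonglongrightarrow> 0"
      by (simp only: filterlim_sequentially_Suc[of "\<lambda>n. x n / w n - H n / w n"])
    show ?thesis
      using tendsto_add[OF diff, of "\<lambda>n. H n / w n" L] tendsto_diff[OF _ diff, of "\<lambda>n. x n / w n" L]
      by auto
  qed
  show ?thesis
  proof
    assume H_lim: "(\<lambda>n. H n / w n) \<longlonglongrightarrow> L"
    obtain A where "A \<ge> 0" "\<And>n. \<bar>H n\<bar> \<le> A * w n"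
      using weighted_convergent_imp_bounded[OF w H_lim] by blast
    then obtain M where "M \<ge> 0" "\<And>n. \<bar>x n\<bar> \<le> M * w n"
      using forcing_bound_transfers[OF f k rec w] by blast
    then show "(\<lambda>n. x n / w n) \<longlonglongrightarrow> L"
      using limits_agree H_lim by blast
  next
    assume x_lim: "(\<lambda>n. x n / w n) \<longlonglongrightarrow> L"
    obtain M where "M \<ge> 0" "\<And>n. \<bar>x n\<bar> \<le> M * w n"
      using weighted_convergent_imp_bounded[OF w x_lim] by blast
    then show "(\<lambda>n. H n / w n) \<longlonglongrightarrow> L"
      using limits_agree x_lim by blast
  qed
qed

lemma weighted_limits_imp_ratio:
  assumes "growth_weight w" and "(\<lambda>n. x n / w n) \<longlonglongrightarrow> L" and "(\<lambda>n. H n / w n) \<longlonglongrightarrow> L" and "L \<noteq> 0"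
  shows "(\<lambda>n. x n / H n) \<longlonglongrightarrow> 1"
proof -
  have "w n \<noteq> 0" for n
    using assms(1) unfolding growth_weight_def by (metis not_one_le_zero)
  then have "(x n / w n) / (H n / w n) = x n / H n" for n
    by simp
  then show ?thesis
    using tendsto_divide[OF assms(2,3,4)] by (simp only: divide_self[OF assms(4)])
qed

theorem theorem3:
  fixes f :: "real \<Rightarrow> real" and k H x :: "nat \<Rightarrow> real" and \<xi> :: real
  assumes "continuous_on UNIV f"
    and "((\<lambda>t. f t / t) \<longlongrightarrow> 0) at_infinity"
    and "summable (\<lambda>j. \<bar>k j\<bar>)"
    and "x 0 = \<xi>"
    and "\<And>n. x (Suc n) = H (Suc n) + (\<Sum>j=0..n. k (n - j) * f (x j))"
  shows
    "((asymptotic_to_increasing H \<and> filterlim H at_top sequentially) \<longleftrightarrow>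
      (asymptotic_to_increasing x \<and> filterlim x at_top sequentially)) \<and>
     (asymptotic_to_increasing H \<and> filterlim H at_top sequentially \<longrightarrow>
      (\<lambda>n. x n / H n) \<longlonglongrightarrow> 1) \<and>
     (asymptotic_to_increasing x \<and> filterlim x at_top sequentially \<longrightarrow>
      (\<lambda>n. x n / H n) \<longlonglongrightarrow> 1) \<and>
     ((asymptotic_to_decreasing H \<and> filterlim H at_bot sequentially) \<longleftrightarrow>
      (asymptotic_to_decreasing x \<and> filterlim x at_bot sequentially)) \<and>
     (asymptotic_to_decreasing H \<and> filterlim H at_bot sequentially \<longrightarrow>
      (\<lambda>n. x n / H n) \<longlonglongrightarrow> 1) \<and>
     (asymptotic_to_decreasing x \<and> filterlim x at_bot sequentially \<longrightarrow>
      (\<lambda>n. x n / H n) \<longlonglongrightarrow> 1)"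
proof -
  note same_limit = solution_forcing_same_weighted_limit[OF assms(1-3,5)]
  have ratio: "(\<lambda>n. x n / H n) \<longlonglongrightarrow> 1"
    if "growth_weight w" "(\<lambda>n. x n / w n) \<longlonglongrightarrow> L" "L \<noteq> 0" for w L
    using weighted_limits_imp_ratio[OF that(1,2) _ that(3)] same_limit[OF that(1)] that(2) by blast
  have weights: "(\<exists>w. growth_weight w \<and> (\<lambda>n. H n / w n) \<longlonglongrightarrow> L) \<longleftrightarrow>
      (\<exists>w. growth_weight w \<and> (\<lambda>n. x n / w n) \<longlonglongrightarrow> L)" for L
    using same_limit by blast
  have "(\<lambda>n. x n / H n) \<longlonglongrightarrow> 1"
    if "\<exists>w. growth_weight w \<and> (\<lambda>n. x n / w n) \<longlonglongrightarrow> L" "L = 1 \<or> L = -1" for L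
    using that ratio by fastforce
  then show ?thesis
    unfolding increasing_divergent_iff_weight decreasing_divergent_iff_weight weights by blast
qed

end
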